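(* Let $R$ be a discrete valuation ring with fraction field $K$, let $L/K$ be a finite field extension, and let $S$ be the integral closure of $R$ in $L$. Then two matrices $A,B\in\mathrm{Mat}_2(R)$ are similar over $R$ (conjugate by an element of $\mathrm{GL}_2(R)$) if and only if they are similar over $S$ (conjugate by an element of $\mathrm{GL}_2(S)$). *)

theory Defs
  imports
    "Jordan_Normal_Form.Matrix"
    "HOL-Computational_Algebra.Polynomial_Factorial"
begin

context comm_ring_1
begin

definition is_ideal :: "'a set \<Rightarrow> bool" where
  "is_ideal I \<longleftrightarrow>
     0 \<in> I \<and> (\<forall>x\<in>I. \<forall>y\<in>I. x + y \<in> I) \<and> (\<forall>c. \<forall>x\<in>I. c * x \<in> I)"

definition is_prime_ideal :: "'a set \<Rightarrow> bool" where
  "is_prime_ideal P \<longleftrightarrow>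
     is_ideal P \<and> P \<noteq> UNIV \<and> (\<forall>x y. x * y \<in> P \<longrightarrow> x \<in> P \<or> y \<in> P)"

end

text \<open>
  A discrete valuation ring is a principal ideal domain with exactly one nonzero prime ideal;
  in particular fields are excluded.
\<close>

class discrete_valuation_ring = idom +
  assumes ideal_principal: "is_ideal I \<Longrightarrow> \<exists>a. I = {x. a dvd x}"
    and ex1_nonzero_prime_ideal: "\<exists>!P. is_prime_ideal P \<and> P \<noteq> {0}"

text \<open>A field extension is given by its structure homomorphism \<open>\<phi>\<close> from \<open>K\<close> to \<open>L\<close>.\<close>

definition finite_field_extension :: "('k::field \<Rightarrow> 'l::field) \<Rightarrow> bool" where
  "finite_field_extension \<phi> \<longleftrightarrow>
     field_hom \<phi> \<and> (\<exists>b. finite_dimensional_vector_space (\<lambda>c x. \<phi> c * x) b)"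

text \<open>The integral closure of \<open>R\<close> in an \<open>R\<close>-algebra with structure homomorphism \<open>f\<close>.\<close>

definition integral_closure :: "('r::comm_ring_1 \<Rightarrow> 'l::comm_ring_1) \<Rightarrow> 'l set" where
  "integral_closure f = {x. \<exists>p. lead_coeff p = 1 \<and> poly (map_poly f p) x = 0}"

text \<open>
  Conjugacy by an element of the general linear group of a subring \<open>S\<close>: both the conjugating
  matrix and its inverse must have entries in \<open>S\<close>.
\<close>

definition similar_mat_over :: "'a::comm_ring_1 set \<Rightarrow> 'a mat \<Rightarrow> 'a mat \<Rightarrow> bool" where
  "similar_mat_over S A B \<longleftrightarrow>
     (\<exists>P Q. elements_mat P \<subseteq> S \<and> elements_mat Q \<subseteq> S \<and> similar_mat_wit A B P Q)"

end

theory Submission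
  imports Defs "Jordan_Normal_Form.Char_Poly"
begin

text \<open>
  Divisibility in \<open>R\<close> is total, so \<open>A = x I + y A'\<close>, where \<open>A'\<close> is not scalar modulo the
  maximal ideal. If \<open>A\<close> and \<open>B\<close> are conjugate over \<open>S\<close>, then \<open>B = x I + y X\<close>, where \<open>X\<close> is a
  conjugate of \<open>A'\<close> over \<open>S\<close>. For \<open>y \<noteq> 0\<close> its entries lie in \<open>S \<inter> K = R\<close>, and by symmetry \<open>X\<close>
  is not scalar modulo the maximal ideal either. Hence \<open>A'\<close> and \<open>X\<close> both have a cyclic vector over
  \<open>R\<close>, that is, they are similar over \<open>R\<close> to the companion matrix of their common characteristic
  polynomial.
\<close>

section \<open>Discrete valuation rings are valuation rings\<close>

text \<open>This is the ideal \<open>M + (x)\<close>. It enlarges a maximal element in the Zorn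
  argument and, for principal \<open>M\<close>, it is the ideal generated by two elements.\<close>

lemma is_ideal_add_multiples:
  fixes M :: "'a::comm_ring_1 set"
  assumes "is_ideal M"
  shows "is_ideal {m + r * x | m r. m \<in> M}"
  unfolding is_ideal_def
proof (intro conjI ballI allI)
  show "0 \<in> {m + r * x | m r. m \<in> M}"
    using assms unfolding is_ideal_def by (auto intro!: exI[of _ 0])
next
  fix y z assume "y \<in> {m + r * x | m r. m \<in> M}" "z \<in> {m + r * x | m r. m \<in> M}"
  then obtain m r n s where "y = m + r * x" "z = n + s * x" "m \<in> M" "n \<in> M" by auto
  then show "y + z \<in> {m + r * x | m r. m \<in> M}"
    using assms unfolding is_ideal_def
    by (intro CollectI exI[of _ "m + n"] exI[of _ "r + s"]) (auto simp: algebra_simps)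
next
  fix c y assume "y \<in> {m + r * x | m r. m \<in> M}"
  then obtain m r where "y = m + r * x" "m \<in> M" by auto
  then show "c * y \<in> {m + r * x | m r. m \<in> M}"
    using assms unfolding is_ideal_def
    by (intro CollectI exI[of _ "c * m"] exI[of _ "c * r"]) (auto simp: algebra_simps)
qed

lemma is_ideal_Union_chain:
  fixes C :: "'a::comm_ring_1 set set"
  assumes "C \<noteq> {}" and "\<And>I. I \<in> C \<Longrightarrow> is_ideal I"
    and "\<And>I J. I \<in> C \<Longrightarrow> J \<in> C \<Longrightarrow> I \<subseteq> J \<or> J \<subseteq> I"
  shows "is_ideal (\<Union>C)"
  unfolding is_ideal_def
proof (intro conjI ballI allI)
  show "0 \<in> \<Union>C"
    using assms(1,2) unfolding is_ideal_def by auto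
next
  fix x y assume "x \<in> \<Union>C" "y \<in> \<Union>C"
  then obtain I J where "I \<in> C" "J \<in> C" "x \<in> I" "y \<in> J" by auto
  then obtain K where "K \<in> C" "x \<in> K" "y \<in> K"
    using assms(3)[of I J] by auto
  then show "x + y \<in> \<Union>C"
    using assms(2) unfolding is_ideal_def by blast
next
  fix c x assume "x \<in> \<Union>C"
  then show "c * x \<in> \<Union>C"
    using assms(2) unfolding is_ideal_def by blast
qed

text \<open>By Zorn's lemma there is an ideal maximal among those that contain \<open>c\<close> and
  miss \<open>1\<close>; such an ideal is prime. This gives access to the uniqueness axiom for prime
  ideals.\<close>

lemma nonunit_in_prime_ideal:
  fixes c :: "'a::comm_ring_1"
  assumes "\<not> c dvd 1"
  obtains P where "is_prime_ideal P" "c \<in> P"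
proof -
  define F where "F = {I. is_ideal I \<and> c \<in> I \<and> 1 \<notin> I}"
  have ne: "{x. c dvd x} \<in> F"
    using assms unfolding F_def is_ideal_def by auto
  have "\<exists>M\<in>F. \<forall>X\<in>F. M \<subseteq> X \<longrightarrow> X = M"
  proof (rule subset_Zorn_nonempty)
    show "F \<noteq> {}" using ne by auto
  next
    fix C assume C: "C \<noteq> {}" "subset.chain F C"
    then have CF: "C \<subseteq> F" by (simp add: subset.chain_def)
    have "is_ideal (\<Union>C)"
      using C CF by (intro is_ideal_Union_chain) (auto simp: F_def subset_chain_def)
    then show "\<Union>C \<in> F"
      using C(1) CF unfolding F_def by auto
  qed
  then obtain M where M: "M \<in> F" and max: "\<And>X. X \<in> F \<Longrightarrow> M \<subseteq> X \<Longrightarrow> X = M"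
    by blast
  have M': "is_ideal M" "c \<in> M" "1 \<notin> M" using M by (auto simp: F_def)
  \<comment> \<open>For \<open>x\<close> outside \<open>M\<close>, maximality forces
    \<open>1\<close> into \<open>M + (x)\<close>; multiplying \<open>1 = m + r * x\<close> by
    \<open>y\<close> leaves only terms of \<open>M\<close>.\<close>
  have "y \<in> M" if xy: "x * y \<in> M" and x: "x \<notin> M" for x y
  proof -
    define N where "N = {m + r * x | m r. m \<in> M}"
    have N: "is_ideal N" unfolding N_def by (rule is_ideal_add_multiples[OF M'(1)])
    have sub: "M \<subseteq> N" unfolding N_def by (force intro: exI[of _ 0])
    have "0 \<in> M" using M'(1) unfolding is_ideal_def by blast
    then have "x \<in> N" unfolding N_def by (intro CollectI exI[of _ 0] exI[of _ 1]) auto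
    then have "N \<noteq> M" using x by auto
    then have "N \<notin> F" using max sub by blast
    then have "1 \<in> N" using N sub M'(2) by (auto simp: F_def)
    then obtain m r where m: "m \<in> M" "1 = m + r * x" unfolding N_def by auto
    have "y = (m + r * x) * y" using m(2) by simp
    also have "\<dots> = y * m + r * (x * y)" by (simp add: algebra_simps)
    finally show "y \<in> M"
      using m(1) xy M'(1) unfolding is_ideal_def by metis
  qed
  then have "is_prime_ideal M"
    using M' unfolding is_prime_ideal_def by blast
  then show thesis using that M'(2) by blast
qed

text \<open>After division by a generator of \<open>(a, b)\<close> the cofactors \<open>a'\<close>
  and \<open>b'\<close> generate the unit ideal. If both were non-units, the unique nonzero prime
  ideal would contain both, hence also \<open>1\<close>.\<close>

lemma dvr_dvd_linear:
  fixes a b :: "'a::discrete_valuation_ring"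
  shows "a dvd b \<or> b dvd a"
proof (cases "a = 0 \<or> b = 0")
  case False
  have aI: "is_ideal {x. a dvd x}" by (auto simp: is_ideal_def)
  define I where "I = {m + r * b | m r. m \<in> {x. a dvd x}}"
  have "is_ideal I" unfolding I_def by (rule is_ideal_add_multiples[OF aI])
  then obtain d where d: "I = {x. d dvd x}" using ideal_principal by blast
  have "a \<in> I" unfolding I_def by (intro CollectI exI[of _ a] exI[of _ 0]) auto
  moreover have "b \<in> I" unfolding I_def by (intro CollectI exI[of _ 0] exI[of _ 1]) auto
  ultimately obtain a' b' where ab: "a = d * a'" "b = d * b'"
    using d by (auto elim!: dvdE)
  have "d \<in> I" using d by auto
  then obtain u v where "d = a * u + v * b" unfolding I_def by (auto elim!: dvdE)
  then have "d * 1 = d * (a' * u + v * b')" using ab by (simp add: algebra_simps)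
  moreover have "d \<noteq> 0" using False ab by auto
  ultimately have bez: "1 = a' * u + v * b'" using mult_left_cancel by blast
  have "a' dvd 1 \<or> b' dvd 1"
  proof (rule ccontr)
    assume "\<not> ?thesis"
    then obtain P Q where P: "is_prime_ideal P" "a' \<in> P" and Q: "is_prime_ideal Q" "b' \<in> Q"
      using nonunit_in_prime_ideal by metis
    have "P \<noteq> {0}" "Q \<noteq> {0}" using P(2) Q(2) ab False by auto
    then have "P = Q" using ex1_nonzero_prime_ideal P(1) Q(1) by blast
    then have "u * a' + v * b' \<in> P"
      using P Q unfolding is_prime_ideal_def is_ideal_def by blast
    then have one: "1 \<in> P" using bez by (simp add: mult.commute)
    have "x \<in> P" for x
    proof -
      have "x * 1 \<in> P" using P(1) one unfolding is_prime_ideal_def is_ideal_def by blast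
      then show ?thesis by simp
    qed
    then show False using P(1) unfolding is_prime_ideal_def by blast
  qed
  then show ?thesis
    unfolding ab by (metis dvd_mult_unit_iff dvd_triv_left mult_dvd_mono one_dvd dvd_refl dvd_trans)
qed auto

text \<open>Locality follows from total divisibility: if \<open>y\<close> divides
  \<open>x + y\<close> it divides the unit \<open>x\<close>, which is excluded; otherwise
  \<open>x + y\<close> divides \<open>y\<close>, hence \<open>x\<close>.\<close>

lemma dvr_unit_add_nonunit:
  fixes x y :: "'a::discrete_valuation_ring"
  assumes "x dvd 1" "\<not> y dvd 1"
  shows "(x + y) dvd 1"
proof (rule disjE[OF dvr_dvd_linear[of y "x + y"]])
  assume "y dvd x + y"
  then have "y dvd x" by (simp add: dvd_add_left_iff)
  then show ?thesis using assms dvd_trans by blast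
next
  assume "x + y dvd y"
  then have "x + y dvd (x + y) - y" by (intro dvd_diff) auto
  then show ?thesis using assms(1) dvd_trans by auto
qed

text \<open>By totality one of the three elements divides the other two. Taking it as
  \<open>d\<close> allows its own cofactor to be \<open>1\<close>, even when all three are
  zero.\<close>

lemma dvr_common_divisor3:
  fixes x y z :: "'a::discrete_valuation_ring"
  obtains d x' y' z' where "x = d * x'" "y = d * y'" "z = d * z'"
    "x' = 1 \<or> y' = 1 \<or> z' = 1"
proof -
  have "\<exists>d\<in>{x, y, z}. d dvd x \<and> d dvd y \<and> d dvd z"
    using dvr_dvd_linear[of x y] dvr_dvd_linear[of y z] dvr_dvd_linear[of x z]
    by (auto intro: dvd_trans)
  then obtain d where d: "d = x \<or> d = y \<or> d = z" "d dvd x" "d dvd y" "d dvd z" by blast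
  then obtain x' y' z' where "x = d * x'" "y = d * y'" "z = d * z'" by (auto elim!: dvdE)
  then show thesis
    using d(1) that[of d 1 y' z'] that[of d x' 1 z'] that[of d x' y' 1] by auto
qed

section \<open>Integral closure\<close>

lemma (in comm_ring_hom) module_via_hom: "Modules.module (\<lambda>r x. hom r * x)"
  by unfold_locales (auto simp: algebra_simps hom_distribs)

text \<open>The determinant trick: the vector listing \<open>G\<close> is an eigenvector, with eigenvalue \<open>z\<close>, of a
  matrix over the base ring, so \<open>z\<close> is a root of its characteristic polynomial.\<close>

lemma integral_closure_if_stable:
  fixes f :: "'r::comm_ring_1 \<Rightarrow> 'l::field"
  assumes "comm_ring_hom f" and fin: "finite G" and g0: "g0 \<in> G" "g0 \<noteq> 0"
    and stab: "\<And>g. g \<in> G \<Longrightarrow> z * g \<in> Modules.module.span (\<lambda>r x. f r * x) G"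
  shows "z \<in> integral_closure f"
proof -
  interpret comm_ring_hom f by fact
  interpret Modules.module "\<lambda>r x. f r * x" by (rule module_via_hom)
  obtain gs where gs: "set gs = G" "distinct gs" using finite_distinct_list[OF fin] by blast
  define n where "n = length gs"
  have "\<exists>u. z * g = (\<Sum>v\<in>G. f (u v) * v)" if "g \<in> G" for g
    using stab[OF that] unfolding span_finite[OF fin] by auto
  then obtain c where c: "\<And>g. g \<in> G \<Longrightarrow> z * g = (\<Sum>v\<in>G. f (c g v) * v)" by metis
  define M where "M = mat n n (\<lambda>(i, j). c (gs ! i) (gs ! j))"
  define v where "v = vec n (\<lambda>i. gs ! i)"
  have M: "M \<in> carrier_mat n n" unfolding M_def by simp
  have "map_mat f M *\<^sub>v v = z \<cdot>\<^sub>v v"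
  proof (rule eq_vecI)
    fix i assume "i < dim_vec (z \<cdot>\<^sub>v v)"
    then have i: "i < n" by (simp add: v_def)
    then have "(z \<cdot>\<^sub>v v) $ i = z * gs ! i" by (simp add: v_def)
    also have "\<dots> = (\<Sum>v\<in>G. f (c (gs ! i) v) * v)"
      using i gs(1) by (intro c) (auto simp: n_def)
    also have "\<dots> = (\<Sum>j<n. f (c (gs ! i) (gs ! j)) * gs ! j)"
      by (rule sum.reindex_bij_betw[OF bij_betw_nth, symmetric])
        (use gs in \<open>auto simp: n_def\<close>)
    also have "\<dots> = (map_mat f M *\<^sub>v v) $ i"
      using i by (simp add: M_def v_def scalar_prod_def atLeast0LessThan)
    finally show "(map_mat f M *\<^sub>v v) $ i = (z \<cdot>\<^sub>v v) $ i" by simp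
  qed (simp add: M_def v_def)
  \<comment> \<open>An eigenvector must be nonzero; the entry \<open>g0\<close> ensures
    this.\<close>
  moreover have "v \<noteq> 0\<^sub>v n"
  proof
    assume v0: "v = 0\<^sub>v n"
    obtain i where i: "i < n" "gs ! i = g0" using g0(1) gs(1) by (auto simp: n_def in_set_conv_nth)
    have "v $ i = 0" using i(1) unfolding v0 by simp
    then show False using i g0(2) by (simp add: v_def)
  qed
  ultimately have "eigenvalue (map_mat f M) z"
    unfolding eigenvalue_def eigenvector_def using M by (auto simp: v_def intro!: exI[of _ v])
  then have "poly (map_poly f (char_poly M)) z = 0"
    using eigenvalue_root_char_poly[of "map_mat f M" n z] M char_poly_hom[OF M] by simp
  then show ?thesis
    unfolding integral_closure_def using degree_monic_char_poly[OF M] by auto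
qed

lemma integral_power_reduction:
  fixes f :: "'r::comm_ring_1 \<Rightarrow> 'l::field"
  assumes "comm_ring_hom f" "x \<in> integral_closure f"
  obtains n c where "n > 0" "x ^ n = (\<Sum>i<n. f (c i) * x ^ i)"
proof -
  interpret comm_ring_hom f by fact
  obtain p where p: "lead_coeff p = 1" "poly (map_poly f p) x = 0"
    using assms(2) unfolding integral_closure_def by auto
  define n where "n = degree p"
  \<comment> \<open>The leading coefficient \<open>1\<close> is sent to \<open>1\<close>, so the
    degree does not drop.\<close>
  have deg: "degree (map_poly f p) = n"
    unfolding n_def by (rule degree_map_poly) (use p(1) in auto)
  have "0 = (\<Sum>i\<le>n. f (coeff p i) * x ^ i)"
    using p(2) unfolding poly_altdef deg by simp
  also have "\<dots> = (\<Sum>i<n. f (coeff p i) * x ^ i) + x ^ n"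
    using p(1) by (simp add: lessThan_Suc_atMost[symmetric] n_def)
  finally have eq: "x ^ n = (\<Sum>i<n. f (- coeff p i) * x ^ i)"
    by (simp add: sum_negf hom_distribs eq_neg_iff_add_eq_0 add.commute)
  \<comment> \<open>For \<open>n = 0\<close> the equation would read \<open>1 = 0\<close> in
    \<open>'l\<close>.\<close>
  have "n > 0"
    using eq by (cases n) auto
  then show thesis using eq by (rule that)
qed

text \<open>\<open>G\<close> consists of the monomials \<open>x ^ i * y ^ j\<close> with
  \<open>i < n\<close> and \<open>j < m\<close>. Multiplication by \<open>x\<close> or
  \<open>y\<close> leaves this range only at exponent \<open>n\<close> or \<open>m\<close>, where
  the monic equations rewrite the power. The element \<open>1\<close> later serves as the nonzero
  member of \<open>G\<close>.\<close>

lemma integral_closure_pair_stable: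
  fixes f :: "'r::comm_ring_1 \<Rightarrow> 'l::field"
  assumes "comm_ring_hom f" "x \<in> integral_closure f" "y \<in> integral_closure f"
  obtains G where "finite G" "1 \<in> G"
    "\<And>g. g \<in> G \<Longrightarrow> x * g \<in> Modules.module.span (\<lambda>r x. f r * x) G"
    "\<And>g. g \<in> G \<Longrightarrow> y * g \<in> Modules.module.span (\<lambda>r x. f r * x) G"
proof -
  interpret comm_ring_hom f by fact
  interpret Modules.module "\<lambda>r x. f r * x" by (rule module_via_hom)
  obtain n c where n: "n > 0" "x ^ n = (\<Sum>i<n. f (c i) * x ^ i)"
    using integral_power_reduction[OF assms(1,2)] .
  obtain m d where m: "m > 0" "y ^ m = (\<Sum>i<m. f (d i) * y ^ i)"
    using integral_power_reduction[OF assms(1,3)] .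
  define G where "G = (\<lambda>(i, j). x ^ i * y ^ j) ` ({..<n} \<times> {..<m})"
  have G: "x ^ i * y ^ j \<in> span G" if "i < n" "j < m" for i j
    by (rule span_base) (use that in \<open>auto simp: G_def\<close>)
  have Gx: "x ^ i * y ^ j \<in> span G" if "i \<le> n" "j < m" for i j
  proof (cases "i = n")
    case True
    have "x ^ n * y ^ j = (\<Sum>i<n. f (c i) * (x ^ i * y ^ j))"
      unfolding n(2) by (simp add: sum_distrib_right mult.assoc)
    also have "\<dots> \<in> span G"
      by (intro span_sum span_scale G) (use that in auto)
    finally show ?thesis using True by simp
  qed (use that in \<open>auto intro: G\<close>)
  have Gy: "x ^ i * y ^ j \<in> span G" if "i < n" "j \<le> m" for i j
  proof (cases "j = m")
    case True
    have "x ^ i * y ^ m = (\<Sum>j<m. f (d j) * (x ^ i * y ^ j))"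
      unfolding m(2) by (simp add: sum_distrib_left mult_ac)
    also have "\<dots> \<in> span G"
      by (intro span_sum span_scale G) (use that in auto)
    finally show ?thesis using True by simp
  qed (use that in \<open>auto intro: G\<close>)
  show thesis
  proof (rule that[of G])
    show "finite G" by (simp add: G_def)
    show "1 \<in> G" unfolding G_def using n(1) m(1) by (auto intro!: image_eqI[of _ _ "(0, 0)"])
    fix g assume "g \<in> G"
    then obtain i j where ij: "i < n" "j < m" "g = x ^ i * y ^ j" unfolding G_def by auto
    show "x * g \<in> span G"
      using Gx[of "Suc i" j] ij by (simp add: mult_ac)
    show "y * g \<in> span G"
      using Gy[of i "Suc j"] ij by (simp add: mult_ac)
  qed
qed

lemma
  fixes f :: "'r::comm_ring_1 \<Rightarrow> 'l::field"
  assumes hom: "comm_ring_hom f" and "x \<in> integral_closure f" "y \<in> integral_closure f"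
  shows integral_closure_add: "x + y \<in> integral_closure f"
    and integral_closure_mult: "x * y \<in> integral_closure f"
proof -
  interpret comm_ring_hom f by fact
  interpret Modules.module "\<lambda>r x. f r * x" by (rule module_via_hom)
  obtain G where G: "finite G" "1 \<in> G" and
    x: "\<And>g. g \<in> G \<Longrightarrow> x * g \<in> span G" and y: "\<And>g. g \<in> G \<Longrightarrow> y * g \<in> span G"
    using integral_closure_pair_stable[OF assms] by blast
  show "x + y \<in> integral_closure f"
    by (rule integral_closure_if_stable[OF hom G]) (auto simp: distrib_right intro: span_add x y)
  \<comment> \<open>Since \<open>y * g\<close> lies only in the span of \<open>G\<close>, stability
    under \<open>x\<close> has to be extended linearly before the two can be composed.\<close>
  have "x * g \<in> span G" if "g \<in> span G" for g
    using that
  proof (induction rule: span_induct_alt)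
    case base
    then show ?case by (simp add: span_zero)
  next
    case (step c g h)
    have "x * (f c * g + h) = f c * (x * g) + x * h" by (simp add: algebra_simps)
    then show ?case using step by (auto intro: span_add span_scale x)
  qed
  then show "x * y \<in> integral_closure f"
    by (intro integral_closure_if_stable[OF hom G]) (auto simp: mult.assoc y)
qed

lemma integral_closure_hom:
  assumes "comm_ring_hom f"
  shows "f r \<in> integral_closure f"
proof -
  interpret comm_ring_hom f by fact
  show ?thesis
    unfolding integral_closure_def by (auto intro!: exI[of _ "[:-r, 1:]"] simp: hom_distribs)
qed

lemma integral_closure_sum:
  fixes f :: "'r::comm_ring_1 \<Rightarrow> 'l::field"
  assumes "comm_ring_hom f" and "\<And>i. i \<in> I \<Longrightarrow> g i \<in> integral_closure f"
  shows "sum g I \<in> integral_closure f"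
proof -
  interpret comm_ring_hom f by fact
  have "0 \<in> integral_closure f" using integral_closure_hom[OF assms(1), of 0] by simp
  then show ?thesis using assms(2)
    by (induction I rule: infinite_finite_induct) (auto intro: integral_closure_add[OF assms(1)])
qed

lemma elements_mat_mult_integral_closure:
  fixes f :: "'r::comm_ring_1 \<Rightarrow> 'l::field"
  assumes "comm_ring_hom f" and P: "P \<in> carrier_mat n n" and Q: "Q \<in> carrier_mat n n"
    and "elements_mat P \<subseteq> integral_closure f" "elements_mat Q \<subseteq> integral_closure f"
  shows "elements_mat (P * Q) \<subseteq> integral_closure f"
proof
  fix z assume "z \<in> elements_mat (P * Q)"
  then obtain i j where ij: "i < n" "j < n" "z = (P * Q) $$ (i, j)" using P Q by fastforce
  then have "z = (\<Sum>k\<in>{0..<n}. P $$ (i, k) * Q $$ (k, j))"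
    using P Q by (simp add: scalar_prod_def)
  also have "\<dots> \<in> integral_closure f"
    using assms(4,5) ij elements_matI[OF P] elements_matI[OF Q]
    by (intro integral_closure_sum integral_closure_mult assms(1)) (auto simp: subset_iff)
  finally show "z \<in> integral_closure f" .
qed

text \<open>The equation \<open>f r = f s * x\<close> expresses that \<open>x\<close> is the
  fraction \<open>r / s\<close>. If \<open>s = r * t\<close>, then \<open>x\<close> is the inverse
  of \<open>f t\<close>, and clearing denominators in the integral equation shows that
  \<open>t\<close> is a unit.\<close>

lemma dvr_integrally_closed:
  fixes f :: "'r::discrete_valuation_ring \<Rightarrow> 'l::field"
  assumes "inj_comm_ring_hom f" and x: "x \<in> integral_closure f" and eq: "f r = f s * x" and "s \<noteq> 0"
  shows "s dvd r"
proof (rule disjE[OF dvr_dvd_linear[of s r]])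
  interpret inj_comm_ring_hom f by fact
  assume "r dvd s"
  then obtain t where t: "s = r * t" by (rule dvdE)
  have "f r * 1 = f r * (f t * x)" using eq t by (simp add: hom_distribs)
  moreover have "f r \<noteq> 0" using t \<open>s \<noteq> 0\<close> by auto
  ultimately have tx: "f t * x = 1" by (metis mult_left_cancel)
  obtain n c where n: "n > 0" "x ^ n = (\<Sum>i<n. f (c i) * x ^ i)"
    using integral_power_reduction[OF comm_ring_hom_axioms x] .
  have cancel: "f t ^ n * x ^ i = f t ^ (n - i)" if "i \<le> n" for i
  proof -
    have "f t ^ n = f t ^ (n - i) * f t ^ i" using that by (simp flip: power_add)
    then show ?thesis using tx by (simp add: mult.assoc flip: power_mult_distrib)
  qed
  have "f 1 = f t ^ n * x ^ n" using cancel[of n] by simp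
  also have "\<dots> = (\<Sum>i<n. f (c i) * (f t ^ n * x ^ i))"
    unfolding n(2) by (simp add: sum_distrib_left mult_ac)
  also have "\<dots> = (\<Sum>i<n. f (c i) * f t ^ (n - i))"
    by (intro sum.cong refl) (simp add: cancel)
  also have "\<dots> = f (\<Sum>i<n. c i * t ^ (n - i))"
    by (simp add: hom_distribs)
  finally have "1 = (\<Sum>i<n. c i * t ^ (n - i))" by simp
  \<comment> \<open>Every exponent \<open>n - i\<close> is positive because
    \<open>i < n\<close>.\<close>
  moreover have "t dvd (\<Sum>i<n. c i * t ^ (n - i))"
    by (intro dvd_sum dvd_mult dvd_power) auto
  ultimately have "t dvd 1" by simp
  then show "s dvd r" unfolding t by (simp add: mult_unit_dvd_iff)
qed

section \<open>Similarity of matrices\<close>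

text \<open>Conjugation is linear and fixes scalar matrices. The witnesses \<open>P\<close> and
  \<open>Q\<close> stay the same, so their entries remain in any prescribed subring.\<close>

lemma similar_mat_wit_affine:
  fixes A B :: "'a::comm_ring_1 mat"
  assumes "similar_mat_wit A B P Q" and A: "A \<in> carrier_mat n n"
  shows "similar_mat_wit (a \<cdot>\<^sub>m 1\<^sub>m n + d \<cdot>\<^sub>m A) (a \<cdot>\<^sub>m 1\<^sub>m n + d \<cdot>\<^sub>m B) P Q"
proof -
  note w = similar_mat_witD2[OF A assms(1)]
  show ?thesis
  proof (rule similar_mat_witI[of _ _ n])
    have "P * (a \<cdot>\<^sub>m 1\<^sub>m n + d \<cdot>\<^sub>m B) = a \<cdot>\<^sub>m P + d \<cdot>\<^sub>m (P * B)"
      using w(4-7)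
      by (simp add: mult_add_distrib_mat[of _ n n _ n] mult_smult_distrib[of _ n n _ n])
    also have "\<dots> * Q = a \<cdot>\<^sub>m (P * Q) + d \<cdot>\<^sub>m (P * B * Q)"
      using w(4-7)
      by (simp add: add_mult_distrib_mat[of _ n n _ _ n] mult_smult_assoc_mat[of _ n n _ n])
    finally show "a \<cdot>\<^sub>m 1\<^sub>m n + d \<cdot>\<^sub>m A = P * (a \<cdot>\<^sub>m 1\<^sub>m n + d \<cdot>\<^sub>m B) * Q"
      using w by simp
  qed (use w in auto)
qed

lemma similar_mat_affine:
  fixes A B :: "'a::comm_ring_1 mat"
  assumes "similar_mat A B" and "A \<in> carrier_mat n n"
  shows "similar_mat (a \<cdot>\<^sub>m 1\<^sub>m n + d \<cdot>\<^sub>m A) (a \<cdot>\<^sub>m 1\<^sub>m n + d \<cdot>\<^sub>m B)"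
  using similar_mat_wit_affine[OF _ assms(2)] assms(1) unfolding similar_mat_def by blast

text \<open>Scalar matrices are central, so each is alone in its conjugacy class. This settles the
  degenerate case in which the factor \<open>y\<close> vanishes.\<close>

lemma similar_mat_scalarD:
  fixes A :: "'a::comm_ring_1 mat"
  assumes "similar_mat A (a \<cdot>\<^sub>m 1\<^sub>m n)"
  shows "A = a \<cdot>\<^sub>m 1\<^sub>m n"
proof -
  obtain P Q where w: "similar_mat_wit A (a \<cdot>\<^sub>m 1\<^sub>m n) P Q"
    using assms unfolding similar_mat_def by blast
  note D = similar_mat_witD[OF refl w]
  have n: "dim_row A = n" using D(5) by auto
  have "A = P * (a \<cdot>\<^sub>m 1\<^sub>m n) * Q" by (rule D(3))
  also have "\<dots> = a \<cdot>\<^sub>m (P * Q)"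
    using D(6,7) unfolding n by (simp add: mult_smult_distrib[of _ n n _ n] mult_smult_assoc_mat[of _ n n _ n])
  finally show ?thesis using D(1) n by simp
qed

lemma similar_mat_over_sym: "similar_mat_over S A B \<Longrightarrow> similar_mat_over S B A"
  unfolding similar_mat_over_def using similar_mat_wit_sym by blast

lemma similar_mat_over_imp_similar_mat: "similar_mat_over S A B \<Longrightarrow> similar_mat A B"
  unfolding similar_mat_over_def similar_mat_def by blast

lemma similar_mat_imp_similar_mat_over:
  fixes f :: "'r::comm_ring_1 \<Rightarrow> 'l::comm_ring_1"
  assumes "comm_ring_hom f" "similar_mat A B"
  shows "similar_mat_over (integral_closure f) (map_mat f A) (map_mat f B)"
proof -
  interpret comm_ring_hom f by fact
  obtain P Q where w: "similar_mat_wit A B P Q" using assms(2) unfolding similar_mat_def by blast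
  define n where "n = dim_row A"
  note D = similar_mat_witD[OF n_def w]
  have "similar_mat_wit (map_mat f A) (map_mat f B) (map_mat f P) (map_mat f Q)"
  proof (rule similar_mat_witI[of _ _ n])
    show "map_mat f P * map_mat f Q = 1\<^sub>m n" "map_mat f Q * map_mat f P = 1\<^sub>m n"
      using D mat_hom_mult[of P n n Q n] mat_hom_mult[of Q n n P n] mat_hom_one by auto
    show "map_mat f A = map_mat f P * map_mat f B * map_mat f Q"
      using D mat_hom_mult[of P n n B n] mat_hom_mult[of "P * B" n n Q n] by auto
  qed (use D in auto)
  then show ?thesis
    unfolding similar_mat_over_def
    by (intro exI[of _ "map_mat f P"] exI[of _ "map_mat f Q"])
      (auto simp: integral_closure_hom[OF assms(1)])
qed

text \<open>Conjugating \<open>A\<close> by the given witnesses yields \<open>X\<close> with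
  \<open>f B = a I + d X\<close>. The entries of \<open>X\<close> are integral and are fractions
  with denominator \<open>d\<close>, so integral closedness puts them in the image of
  \<open>f\<close>; \<open>B'\<close> is the preimage of \<open>X\<close>.\<close>

lemma similar_mat_over_affine_descent:
  fixes f :: "'r::discrete_valuation_ring \<Rightarrow> 'l::field"
  assumes inj: "inj_comm_ring_hom f" and A: "A \<in> carrier_mat n n" and B: "B \<in> carrier_mat n n"
    and "d \<noteq> 0"
    and sim: "similar_mat_over (integral_closure f) (map_mat f (a \<cdot>\<^sub>m 1\<^sub>m n + d \<cdot>\<^sub>m A)) (map_mat f B)"
  obtains B' where "B' \<in> carrier_mat n n" "B = a \<cdot>\<^sub>m 1\<^sub>m n + d \<cdot>\<^sub>m B'"
    "similar_mat_over (integral_closure f) (map_mat f A) (map_mat f B')"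
proof -
  interpret inj_comm_ring_hom f by fact
  note hom = comm_ring_hom_axioms
  have fA: "map_mat f A \<in> carrier_mat n n" and fB: "map_mat f B \<in> carrier_mat n n"
    using A B by auto
  have affA: "f a \<cdot>\<^sub>m 1\<^sub>m n + f d \<cdot>\<^sub>m map_mat f A \<in> carrier_mat n n" using A by simp
  have aff: "map_mat f (a \<cdot>\<^sub>m 1\<^sub>m n + d \<cdot>\<^sub>m A) = f a \<cdot>\<^sub>m 1\<^sub>m n + f d \<cdot>\<^sub>m map_mat f A"
    using A by (intro eq_matI) (auto simp: hom_distribs)
  obtain P Q where PQ: "elements_mat P \<subseteq> integral_closure f" "elements_mat Q \<subseteq> integral_closure f"
    and w: "similar_mat_wit (f a \<cdot>\<^sub>m 1\<^sub>m n + f d \<cdot>\<^sub>m map_mat f A) (map_mat f B) P Q"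
    using sim unfolding similar_mat_over_def aff by blast
  have carr: "P \<in> carrier_mat n n" "Q \<in> carrier_mat n n" and inv: "P * Q = 1\<^sub>m n" "Q * P = 1\<^sub>m n"
    using similar_mat_witD2[OF affA w] by auto
  define X where "X = Q * map_mat f A * P"
  have X: "X \<in> carrier_mat n n" using carr A by (simp add: X_def)
  then have affX: "f a \<cdot>\<^sub>m 1\<^sub>m n + f d \<cdot>\<^sub>m X \<in> carrier_mat n n" by simp
  have "similar_mat_wit X (map_mat f A) Q P"
    by (rule similar_mat_witI[of _ _ n]) (use carr inv A X in \<open>auto simp: X_def\<close>)
  then have wX: "similar_mat_wit (map_mat f A) X P Q" by (rule similar_mat_wit_sym)
  \<comment> \<open>The same conjugation is computed twice: from the given similarity and from the
    affine shift of \<open>wX\<close>.\<close>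
  have "map_mat f B = Q * (f a \<cdot>\<^sub>m 1\<^sub>m n + f d \<cdot>\<^sub>m map_mat f A) * P"
    using similar_mat_witD2(3)[OF fB similar_mat_wit_sym[OF w]] .
  also have "\<dots> = f a \<cdot>\<^sub>m 1\<^sub>m n + f d \<cdot>\<^sub>m X"
    using similar_mat_witD2(3)[OF affX similar_mat_wit_sym[OF similar_mat_wit_affine[OF wX fA]]]
    by simp
  finally have BX: "map_mat f B = f a \<cdot>\<^sub>m 1\<^sub>m n + f d \<cdot>\<^sub>m X" .
  have XS: "elements_mat X \<subseteq> integral_closure f"
    unfolding X_def using carr A PQ
    by (intro elements_mat_mult_integral_closure[OF hom, of _ n])
      (auto simp: integral_closure_hom[OF hom])
  have entry: "f (B $$ (i, j) - a * (if i = j then 1 else 0)) = f d * X $$ (i, j)"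
    if "i < n" "j < n" for i j
    using arg_cong[OF BX, of "\<lambda>M. M $$ (i, j)"] that X B by (auto simp: hom_distribs)
  have "d dvd B $$ (i, j) - a * (if i = j then 1 else 0)" if "i < n" "j < n" for i j
    using dvr_integrally_closed[OF inj _ entry[OF that] \<open>d \<noteq> 0\<close>] XS elements_matI[OF X that refl]
    by blast
  \<comment> \<open>With the bounds under the quantifier, a quotient can be chosen for all index
    pairs at once.\<close>
  then have "\<exists>b. i < n \<longrightarrow> j < n \<longrightarrow> B $$ (i, j) - a * (if i = j then 1 else 0) = d * b" for i j
    by (meson dvdE)
  then obtain b where
    b: "\<And>i j. i < n \<Longrightarrow> j < n \<Longrightarrow> B $$ (i, j) - a * (if i = j then 1 else 0) = d * b i j"
    by metis
  define B' where "B' = mat n n (\<lambda>(i, j). b i j)"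
  have "map_mat f B' = X"
  proof (rule eq_matI)
    fix i j assume "i < dim_row X" "j < dim_col X"
    then have ij: "i < n" "j < n" using X by auto
    have "f d * f (b i j) = f d * X $$ (i, j)"
      using entry[OF ij] b[OF ij] by (simp add: hom_distribs)
    then show "map_mat f B' $$ (i, j) = X $$ (i, j)"
      using ij \<open>d \<noteq> 0\<close> by (simp add: B'_def)
  qed (use X in \<open>auto simp: B'_def\<close>)
  moreover have "B = a \<cdot>\<^sub>m 1\<^sub>m n + d \<cdot>\<^sub>m B'"
  proof (rule eq_matI)
    fix i j assume "i < dim_row (a \<cdot>\<^sub>m 1\<^sub>m n + d \<cdot>\<^sub>m B')" "j < dim_col (a \<cdot>\<^sub>m 1\<^sub>m n + d \<cdot>\<^sub>m B')"
    then have ij: "i < n" "j < n" by (auto simp: B'_def)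
    then show "B $$ (i, j) = (a \<cdot>\<^sub>m 1\<^sub>m n + d \<cdot>\<^sub>m B') $$ (i, j)"
      using b[OF ij] by (auto simp: B'_def algebra_simps)
  qed (use B in \<open>auto simp: B'_def\<close>)
  moreover have "B' \<in> carrier_mat n n" by (simp add: B'_def)
  ultimately show thesis
    using that wX PQ unfolding similar_mat_over_def by blast
qed

section \<open>Two-by-two matrices\<close>

definition mat2 :: "'a \<Rightarrow> 'a \<Rightarrow> 'a \<Rightarrow> 'a \<Rightarrow> 'a mat" where
  "mat2 a b c d = mat 2 2 (\<lambda>(i, j). if i = 0 then if j = 0 then a else b else if j = 0 then c else d)"

lemma mat2_carrier [simp]: "mat2 a b c d \<in> carrier_mat 2 2"
  by (simp add: mat2_def)

lemma mat2_eqI: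
  assumes "A \<in> carrier_mat 2 2" "A $$ (0, 0) = a" "A $$ (0, 1) = b" "A $$ (1, 0) = c" "A $$ (1, 1) = d"
  shows "A = mat2 a b c d"
  using assms by (intro eq_matI) (auto simp: mat2_def less_2_cases_iff)

lemma mat2_index [simp]:
  "mat2 a b c d $$ (0, 0) = a" "mat2 a b c d $$ (0, 1) = b" "mat2 a b c d $$ (0, Suc 0) = b"
  "mat2 a b c d $$ (1, 0) = c" "mat2 a b c d $$ (Suc 0, 0) = c"
  "mat2 a b c d $$ (1, 1) = d" "mat2 a b c d $$ (Suc 0, Suc 0) = d"
  by (simp_all add: mat2_def)

lemma mat2_mult:
  fixes a b c d :: "'a::comm_ring_1"
  shows "mat2 a b c d * mat2 p q r s = mat2 (a * p + b * r) (a * q + b * s) (c * p + d * r) (c * q + d * s)"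
  by (rule mat2_eqI) (auto simp: mat2_def scalar_prod_def numeral_2_eq_2)

lemma mat2_one: "1\<^sub>m 2 = mat2 1 0 0 (1::'a::comm_ring_1)"
  by (rule mat2_eqI) auto

lemma mat2_scalar: "x \<cdot>\<^sub>m 1\<^sub>m 2 = mat2 x 0 0 (x::'a::comm_ring_1)"
  by (rule mat2_eqI) auto

lemma mat2_affine:
  fixes a b c d :: "'a::comm_ring_1"
  shows "x \<cdot>\<^sub>m 1\<^sub>m 2 + y \<cdot>\<^sub>m mat2 a b c d = mat2 (x + y * a) (y * b) (y * c) (x + y * d)"
  by (rule mat2_eqI) (auto simp: mat2_def)

lemma map_mat2: "map_mat f (mat2 a b c d) = mat2 (f a) (f b) (f c) (f d)"
  by (rule mat2_eqI) (auto simp: mat2_def)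

lemma mat2_inject: "mat2 a b c d = mat2 p q r s \<longleftrightarrow> a = p \<and> b = q \<and> c = r \<and> d = s"
  by (metis mat2_index)

lemma mat2_cases:
  assumes "A \<in> carrier_mat 2 2"
  obtains a b c d where "A = mat2 a b c d"
  using mat2_eqI[OF assms refl refl refl refl] by blast

text \<open>An intertwiner with unit determinant is invertible over the ring, so it suffices to
  check \<open>A P = P B\<close>.\<close>

lemma similar_mat2I:
  fixes A B :: "'a::comm_ring_1 mat"
  assumes "A \<in> carrier_mat 2 2" "B \<in> carrier_mat 2 2"
    and eq: "A * mat2 p q r s = mat2 p q r s * B" and unit: "(p * s - q * r) dvd 1"
  shows "similar_mat A B"
proof -
  obtain u where u: "(p * s - q * r) * u = 1" using unit by (metis dvdE)
  define P where "P = mat2 p q r s"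
  \<comment> \<open>This is the adjugate of \<open>P\<close> times the inverse \<open>u\<close> of
    its determinant.\<close>
  define Q where "Q = mat2 (u * s) (- u * q) (- u * r) (u * p)"
  have carr: "P \<in> carrier_mat 2 2" "Q \<in> carrier_mat 2 2" by (auto simp: P_def Q_def)
  have PQ: "P * Q = 1\<^sub>m 2" "Q * P = 1\<^sub>m 2"
    using u by (auto simp: P_def Q_def mat2_mult mat2_one mat2_inject algebra_simps)
  have "A = A * (P * Q)" using PQ assms(1) by simp
  also have "\<dots> = P * B * Q" using eq carr assms(1)
    by (simp add: P_def flip: assoc_mult_mat[of _ 2 2 _ 2 _ 2])
  finally show ?thesis
    using similar_matI[of A B P Q 2] PQ carr assms(1,2) by auto
qed

lemma similar_mat2_trace_det:
  fixes a b c d :: "'a::comm_ring_1"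
  assumes "similar_mat (mat2 a b c d) (mat2 a' b' c' d')"
  shows "a + d = a' + d'" "a * d - b * c = a' * d' - b' * c'"
proof -
  obtain P Q where w: "similar_mat_wit (mat2 a b c d) (mat2 a' b' c' d') P Q"
    using assms unfolding similar_mat_def by blast
  note D = similar_mat_witD2[OF mat2_carrier w]
  obtain p q r s where P: "P = mat2 p q r s" using mat2_cases D(6) by blast
  obtain t u v w where Q: "Q = mat2 t u v w" using mat2_cases D(7) by blast
  have QP: "t * p + u * r = 1" "t * q + u * s = 0" "v * p + w * r = 0" "v * q + w * s = 1"
    using D(2) unfolding P Q mat2_mult mat2_one mat2_inject by auto
  have A: "a = (p * a' + q * c') * t + (p * b' + q * d') * v"
    "b = (p * a' + q * c') * u + (p * b' + q * d') * w"
    "c = (r * a' + s * c') * t + (r * b' + s * d') * v"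
    "d = (r * a' + s * c') * u + (r * b' + s * d') * w"
    using D(3) unfolding P Q mat2_mult mat2_inject by auto
  \<comment> \<open>With \<open>B\<close> the primed matrix, the trace of \<open>P B Q\<close> is
    regrouped as the trace of \<open>B\<close> times \<open>Q P\<close>; the determinant below
    factors as that of \<open>B\<close> times that of \<open>Q P\<close>. Here \<open>Q P\<close> is
    the identity.\<close>
  have "a + d = a' * (t * p + u * r) + c' * (t * q + u * s) + b' * (v * p + w * r)
      + d' * (v * q + w * s)"
    unfolding A by (simp add: algebra_simps)
  then show "a + d = a' + d'" by (simp add: QP)
  have "a * d - b * c = (a' * d' - b' * c')
      * ((t * p + u * r) * (v * q + w * s) - (t * q + u * s) * (v * p + w * r))"
    unfolding A by (simp add: algebra_simps)
  then show "a * d - b * c = a' * d' - b' * c'" by (simp add: QP)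
qed

text \<open>Over a local ring a matrix that is not scalar modulo the maximal ideal has a cyclic vector
  among \<open>(1, 0)\<close>, \<open>(0, 1)\<close>, \<open>(1, 1)\<close>.\<close>

lemma dvr_similar_companion:
  fixes a b c d :: "'a::discrete_valuation_ring"
  assumes "b dvd 1 \<or> c dvd 1 \<or> (a - d) dvd 1"
  shows "similar_mat (mat2 a b c d) (mat2 0 (b * c - a * d) 1 (a + d))"
proof -
  \<comment> \<open>The base change has columns \<open>v = (p, q)\<close> and \<open>A v\<close>,
    where \<open>A\<close> is the given matrix. Its determinant is the stated unit, and
    Cayley-Hamilton gives the second column of the companion matrix.\<close>
  have cyclic: ?thesis if "(p * (c * p + d * q) - (a * p + b * q) * q) dvd 1" for p q
    by (rule similar_mat2I[of _ _ p "a * p + b * q" q "c * p + d * q"])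
      (use that in \<open>auto simp: mat2_mult mat2_inject algebra_simps\<close>)
  \<comment> \<open>For \<open>(1, 0)\<close>, \<open>(0, 1)\<close> and \<open>(1, 1)\<close> the
    determinants are \<open>c\<close>, \<open>- b\<close> and \<open>c + d - (a + b)\<close>. In the
    last case \<open>b\<close> and \<open>c\<close> are non-units, so by locality they do not
    disturb the unit \<open>a - d\<close>.\<close>
  consider "c dvd 1" | "b dvd 1" | "\<not> b dvd 1" "\<not> c dvd 1" "(a - d) dvd 1" using assms by blast
  then show ?thesis
  proof cases
    case 1
    then show ?thesis using cyclic[of 1 0] by simp
  next
    case 2
    then show ?thesis using cyclic[of 0 1] by simp
  next
    case 3
    have "((a - d) + b) dvd 1" using 3 by (intro dvr_unit_add_nonunit)
    then have "(((a - d) + b) + - c) dvd 1" using 3 by (intro dvr_unit_add_nonunit) auto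
    moreover have "c + d - (a + b) = - (((a - d) + b) + - c)" by simp
    ultimately have "(c + d - (a + b)) dvd 1" by (simp only: minus_dvd_iff)
    then show ?thesis using cyclic[of 1 1] by simp
  qed
qed

lemma dvr_mat2_decompose:
  fixes A :: "'a::discrete_valuation_ring mat"
  assumes "A \<in> carrier_mat 2 2"
  obtains x y a b c d where "A = x \<cdot>\<^sub>m 1\<^sub>m 2 + y \<cdot>\<^sub>m mat2 a b c d"
    "b dvd 1 \<or> c dvd 1 \<or> (a - d) dvd 1"
proof -
  obtain a b c d where A: "A = mat2 a b c d" using mat2_cases[OF assms] .
  obtain y b' c' e where y: "b = y * b'" "c = y * c'" "a - d = y * e" "b' = 1 \<or> c' = 1 \<or> e = 1"
    using dvr_common_divisor3 .
  \<comment> \<open>Subtracting \<open>d I\<close> leaves the entries \<open>a - d\<close>,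
    \<open>b\<close>, \<open>c\<close> and \<open>0\<close>; their common factor is
    \<open>y\<close>, with one cofactor equal to \<open>1\<close>. A scalar \<open>A\<close> gives
    \<open>y = 0\<close>.\<close>
  have "A = d \<cdot>\<^sub>m 1\<^sub>m 2 + y \<cdot>\<^sub>m mat2 e b' c' 0"
    unfolding A mat2_affine mat2_inject using y by (auto simp: algebra_simps)
  then show thesis using that y(4) by fastforce
qed

text \<open>Any factor \<open>y\<close> extracted from the non-scalar part of the second matrix also
  divides that of the first by descent. There it divides a unit, so \<open>y\<close> is a unit
  itself.\<close>

lemma similar_mat_over_mat2_unit:
  fixes f :: "'r::discrete_valuation_ring \<Rightarrow> 'l::field"
  assumes inj: "inj_comm_ring_hom f"
    and sim: "similar_mat_over (integral_closure f) (map_mat f (mat2 a b c d)) (map_mat f (mat2 a' b' c' d'))"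
    and unit: "b dvd 1 \<or> c dvd 1 \<or> (a - d) dvd 1"
  shows "b' dvd 1 \<or> c' dvd 1 \<or> (a' - d') dvd 1"
proof -
  interpret inj_comm_ring_hom f by fact
  obtain x y p q r s where B: "mat2 a' b' c' d' = x \<cdot>\<^sub>m 1\<^sub>m 2 + y \<cdot>\<^sub>m mat2 p q r s"
    and u: "q dvd 1 \<or> r dvd 1 \<or> (p - s) dvd 1"
    using dvr_mat2_decompose[OF mat2_carrier] .
  have "y dvd b \<and> y dvd c \<and> y dvd (a - d)"
  proof (cases "y = 0")
    case True
    have "similar_mat (map_mat f (mat2 a b c d)) (f x \<cdot>\<^sub>m 1\<^sub>m 2)"
      using similar_mat_over_imp_similar_mat[OF sim] unfolding B True mat2_affine
      by (simp add: map_mat2 mat2_scalar)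
    then have "map_mat f (mat2 a b c d) = f x \<cdot>\<^sub>m 1\<^sub>m 2"
      by (rule similar_mat_scalarD)
    then have "b = 0" "c = 0" "a = d" by (auto simp: map_mat2 mat2_scalar mat2_inject)
    then show ?thesis by simp
  next
    case False
    \<comment> \<open>Descent is applied in the reverse direction: the affine form of the second
      matrix is carried over to the first.\<close>
    obtain A' where "A' \<in> carrier_mat 2 2" "mat2 a b c d = x \<cdot>\<^sub>m 1\<^sub>m 2 + y \<cdot>\<^sub>m A'"
      using similar_mat_over_affine_descent[OF inj mat2_carrier mat2_carrier False
          similar_mat_over_sym[OF sim[unfolded B]]] by blast
    then show ?thesis
      by (elim mat2_cases) (auto simp: mat2_affine mat2_inject simp flip: right_diff_distrib)
  qed
  then have "y dvd 1" using unit by (meson dvd_trans)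
  moreover have "b' = y * q" "c' = y * r" "a' - d' = y * (p - s)"
    using B by (auto simp: mat2_affine mat2_inject algebra_simps)
  ultimately show ?thesis using u by (metis mult_dvd_mono mult_1)
qed

theorem theorem23:
  fixes \<phi> :: "'r::discrete_valuation_ring fract \<Rightarrow> 'l::field"
    and \<iota> :: "'r \<Rightarrow> 'l"
    and S :: "'l set"
    and A B :: "'r mat"
  assumes "finite_field_extension \<phi>"
    and "\<iota> = \<phi> \<circ> to_fract"
    and "S = integral_closure \<iota>"
    and "A \<in> carrier_mat 2 2"
    and "B \<in> carrier_mat 2 2"
  shows "similar_mat A B \<longleftrightarrow> similar_mat_over S (map_mat \<iota> A) (map_mat \<iota> B)"
proof -
  interpret \<phi>: field_hom \<phi> using assms(1) by (simp add: finite_field_extension_def)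
  have inj: "inj_comm_ring_hom \<iota>"
    unfolding assms(2) by unfold_locales (auto simp: \<phi>.hom_add \<phi>.hom_mult)
  then interpret inj_comm_ring_hom \<iota> .
  show ?thesis
  proof
    assume "similar_mat A B"
    then show "similar_mat_over S (map_mat \<iota> A) (map_mat \<iota> B)"
      unfolding assms(3) by (rule similar_mat_imp_similar_mat_over[OF comm_ring_hom_axioms])
  next
    assume sim: "similar_mat_over S (map_mat \<iota> A) (map_mat \<iota> B)"
    obtain x y a b c d where A: "A = x \<cdot>\<^sub>m 1\<^sub>m 2 + y \<cdot>\<^sub>m mat2 a b c d"
      and u: "b dvd 1 \<or> c dvd 1 \<or> (a - d) dvd 1"
      using dvr_mat2_decompose[OF assms(4)] .
    show "similar_mat A B"
    proof (cases "y = 0")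
      case True
      then have A': "A = x \<cdot>\<^sub>m 1\<^sub>m 2" unfolding A mat2_affine by (simp add: mat2_scalar)
      have "similar_mat (map_mat \<iota> B) (\<iota> x \<cdot>\<^sub>m 1\<^sub>m 2)"
        using similar_mat_over_imp_similar_mat[OF similar_mat_over_sym[OF sim]]
        unfolding A' by (simp add: map_mat2 mat2_scalar)
      then have "map_mat \<iota> B = \<iota> x \<cdot>\<^sub>m 1\<^sub>m 2" by (rule similar_mat_scalarD)
      also have "\<dots> = map_mat \<iota> A" unfolding A' by (simp add: map_mat2 mat2_scalar)
      finally have "B = A" by (rule mat_hom_inj)
      then show ?thesis using similar_mat_refl assms(4) by simp
    next
      case False
      \<comment> \<open>The shift \<open>x\<close> and the factor \<open>y\<close> of
        \<open>A\<close> are stripped from \<open>B\<close> too, leaving a similarity over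
        \<open>S\<close> between the reduced matrices.\<close>
      obtain B' where B': "B' \<in> carrier_mat 2 2" "B = x \<cdot>\<^sub>m 1\<^sub>m 2 + y \<cdot>\<^sub>m B'"
        "similar_mat_over S (map_mat \<iota> (mat2 a b c d)) (map_mat \<iota> B')"
        using similar_mat_over_affine_descent[OF inj mat2_carrier assms(5) False
            sim[unfolded assms(3) A]] unfolding assms(3) by blast
      obtain a' b' c' d' where B'_eq: "B' = mat2 a' b' c' d'" using mat2_cases[OF B'(1)] .
      note sim' = B'(3)[unfolded B'_eq assms(3)]
      have "similar_mat (mat2 (\<iota> a) (\<iota> b) (\<iota> c) (\<iota> d)) (mat2 (\<iota> a') (\<iota> b') (\<iota> c') (\<iota> d'))"
        using similar_mat_over_imp_similar_mat[OF sim'] by (simp add: map_mat2)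
      note td = similar_mat2_trace_det[OF this]
      \<comment> \<open>Trace and determinant agree in \<open>'l\<close>; injectivity of
        \<open>\<iota>\<close> then transfers the equality to \<open>'r\<close>, so the two
        companion matrices coincide.\<close>
      have "\<iota> (a + d) = \<iota> (a' + d')" "\<iota> (b * c - a * d) = \<iota> (b' * c' - a' * d')"
        using td by (simp_all add: hom_distribs algebra_simps)
      then have "a + d = a' + d'" "b * c - a * d = b' * c' - a' * d'"
        unfolding eq_iff by auto
      then have "similar_mat (mat2 a b c d) (mat2 a' b' c' d')"
        using dvr_similar_companion[OF u]
          dvr_similar_companion[OF similar_mat_over_mat2_unit[OF inj sim' u]]
        by (metis similar_mat_trans similar_mat_sym)
      then show ?thesis
        unfolding A B'(2) B'_eq by (rule similar_mat_affine) simp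
    qed
  qed
qed

end
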